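(* Let $q$ be a power of an odd prime. Let $P_i(X)=a_iX^{q^2}+b_iX^q+c_iX\in\mathbb{F}_q[X]$, $i=1,2,3$, be polynomials with no roots in $\mathbb{F}_{q^3}^*$. Suppose that \begin{enumerate} \item $a_1a_2a_3=b_1b_2b_3=c_1c_2c_3$, \item $a_1a_2b_3+a_1b_2a_3+b_1a_2a_3 = b_1b_2c_3+b_1c_2b_3+c_1b_2b_3 = a_1c_2c_3+c_1c_2a_3+c_1a_2c_3$, and \item $a_1a_2c_3+a_1c_2a_3+c_1a_2a_3 = b_1c_2c_3+c_1c_2b_3+c_1b_2c_3 = a_1b_2b_3+b_1a_2b_3+b_1b_2a_3$. \end{enumerate} Define $\alpha=a_1a_2a_3$, $\beta=a_1a_2b_3+a_1b_2a_3+b_1a_2a_3$, $\gamma=a_1a_2c_3+a_1c_2a_3+c_1a_2a_3$ and $\delta=a_1b_2c_3+a_1c_2b_3+b_1a_2c_3+b_1c_2a_3+c_1a_2b_3+c_1b_2a_3$. If the system $$\begin{cases} -A^2D+ABE-B^2C=2\alpha\\ A^2C-ABD-2ACD+2AE^2+B^2E-2BCE+2BD^2=2\beta\\ A^2E-ABC+2AC^2-2ADE+B^2D-2BCD+2BE^2=2\gamma\\ A^3+B^3+4C^3-12CDE+4D^3+4E^3=2\delta \end{cases}$$ has a solution $(E,A,B,C,D)\in\mathbb{F}_q^5$, then the polynomial $$f_{E,A,B,C,D}(X)=EX^2+AX^{q+1}+BX^{q^2+1}+CX^{2q}+DX^{2q^2}$$ is planar over $\mathbb{F}_{q^3}$.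
   Context: For $q$ odd, a function $f:\mathbb{F}_{q^n}\to\mathbb{F}_{q^n}$ is called planar (over $\mathbb{F}_{q^n}$) if for every $\epsilon\in\mathbb{F}_{q^n}^*$ the polynomial $f(X+\epsilon)-f(X)$ induces a permutation of $\mathbb{F}_{q^n}$. *)

theory Defs
  imports "HOL-Computational_Algebra.Computational_Algebra" "HOL-Library.Cardinality"
begin

definition is_subfield :: "'a::field set \<Rightarrow> bool" where
  "is_subfield K \<longleftrightarrow> 0 \<in> K \<and> 1 \<in> K
     \<and> (\<forall>x\<in>K. \<forall>y\<in>K. x + y \<in> K) \<and> (\<forall>x\<in>K. - x \<in> K)
     \<and> (\<forall>x\<in>K. \<forall>y\<in>K. x * y \<in> K) \<and> (\<forall>x\<in>K. x \<noteq> 0 \<longrightarrow> inverse x \<in> K)"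

definition planar :: "('a::{field,finite} \<Rightarrow> 'a) \<Rightarrow> bool" where
  "planar f \<longleftrightarrow> (\<forall>\<epsilon>. \<epsilon> \<noteq> 0 \<longrightarrow> bij (\<lambda>x. f (x + \<epsilon>) - f x))"

definition q_trinomial :: "nat \<Rightarrow> 'a::field \<Rightarrow> 'a \<Rightarrow> 'a \<Rightarrow> 'a poly" where
  "q_trinomial q a b c = monom a (q^2) + monom b q + monom c 1"

definition f_poly :: "nat \<Rightarrow> 'a::field \<Rightarrow> 'a \<Rightarrow> 'a \<Rightarrow> 'a \<Rightarrow> 'a \<Rightarrow> 'a poly" where
  "f_poly q E A B C D =
     monom E 2 + monom A (q + 1) + monom B (q^2 + 1) + monom C (2 * q) + monom D (2 * q^2)"

end

theory Submission
  imports Defs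
begin

text \<open>
  Write \<open>u, v, w\<close> for the conjugates of \<open>\<epsilon>\<close> over \<open>F\<^sub>q\<close>. The map
  \<open>x \<mapsto> f(x + \<epsilon>) - f(x) - f(\<epsilon>)\<close> is a \<open>q\<close>-polynomial \<open>l\<^sub>0 x + l\<^sub>1 x^q + l\<^sub>2 x^(q^2)\<close>, so it is bijective
  as soon as its Dickson determinant does not vanish. This determinant is a ternary cubic form
  in \<open>u, v, w\<close>, invariant under the cyclic shift. Hypotheses (1)-(3) say that
  \<open>\<Prod>\<^sub>i (a\<^sub>i v + b\<^sub>i w + c\<^sub>i u)\<close> is invariant as well, and the four equations say that the
  determinant is \<open>4\<close> times this product. The factors are the values at \<open>\<epsilon>\<close> of the adjoints of
  the \<open>P\<^sub>i\<close> with respect to the trace form, and the adjoint of an invertible linear map is invertible.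
\<close>

text \<open>Translation by 1 permutes \<open>K\<close>, so it leaves the sum of all elements
  unchanged, although it adds 1 once for every element.\<close>

lemma subfield_of_nat_card_eq_0:
  fixes K :: "'a::{field,finite} set"
  assumes "is_subfield K"
  shows "of_nat (card K) = (0 :: 'a)"
proof -
  have "bij_betw (\<lambda>x. x + 1) K K"
    by (rule bij_betwI[where g = "\<lambda>x. x + (- 1)"])
      (use assms in \<open>auto simp: is_subfield_def simp del: add_uminus_conv_diff\<close>)
  then have "(\<Sum>x\<in>K. x + 1) = \<Sum>K"
    by (rule sum.reindex_bij_betw)
  then show ?thesis
    by (simp add: sum.distrib)
qed

text \<open>Multiplication by a nonzero \<open>x\<close> permutes \<open>K - {0}\<close>; comparing
  the products over this set gives \<open>x ^ (card K - 1) = 1\<close>, as in Fermat's little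
  theorem.\<close>

lemma subfield_power_card:
  fixes K :: "'a::{field,finite} set"
  assumes K: "is_subfield K" and x: "x \<in> K"
  shows "x ^ card K = x"
proof (cases "x = 0")
  case True
  then show ?thesis
    using x by (auto simp: card_gt_0_iff)
next
  case False
  have "bij_betw ((*) x) (K - {0}) (K - {0})"
    by (rule bij_betwI[where g = "\<lambda>y. inverse x * y"])
      (use K x False in \<open>auto simp: is_subfield_def\<close>)
  then have "(\<Prod>y\<in>K - {0}. x * y) = \<Prod>(K - {0})"
    by (rule prod.reindex_bij_betw)
  moreover have "\<Prod>(K - {0}) \<noteq> 0"
    by simp
  ultimately have "x ^ card (K - {0}) = 1"
    by (simp add: prod.distrib)
  moreover have "card K = Suc (card (K - {0}))"
    using K by (metis card_Suc_Diff1 finite is_subfield_def)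
  ultimately show ?thesis
    by simp
qed

text \<open>
  The form \<open>(x, y) \<mapsto> Tr (x y)\<close> is nondegenerate, and with respect to it the adjoint of
  \<open>a X^(q^2) + b X^q + c X\<close> is \<open>a X^q + b X^(q^2) + c X\<close>.
\<close>

lemma adjoint_no_root:
  fixes \<phi> :: "'a::{field,finite} \<Rightarrow> 'a"
  assumes add: "\<And>x y. \<phi> (x + y) = \<phi> x + \<phi> y"
    and mult: "\<And>x y. \<phi> (x * y) = \<phi> x * \<phi> y"
    and cube: "\<And>x. \<phi> (\<phi> (\<phi> x)) = x"
    and trace: "\<exists>z. z + \<phi> z + \<phi> (\<phi> z) \<noteq> 0"
    and coeffs: "\<phi> a = a" "\<phi> b = b" "\<phi> c = c"
    and no_root: "\<And>x. x \<noteq> 0 \<Longrightarrow> a * \<phi> (\<phi> x) + b * \<phi> x + c * x \<noteq> 0"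
    and y: "y \<noteq> 0"
  shows "a * \<phi> y + b * \<phi> (\<phi> y) + c * y \<noteq> 0"
proof
  define L where "L x = a * \<phi> (\<phi> x) + b * \<phi> x + c * x" for x
  define r where "r = a * \<phi> y + b * \<phi> (\<phi> y) + c * y"
  assume "a * \<phi> y + b * \<phi> (\<phi> y) + c * y = 0"
  then have "r = 0"
    by (simp add: r_def)
  have \<phi>_0: "\<phi> 0 = 0"
    using add[of 0 0] by (simp only: add_0_right add_cancel_right_right)
  have L_add: "L (x + x') = L x + L x'" for x x'
    by (simp add: L_def add algebra_simps)
  have "inj L"
  proof (rule injI)
    fix x x'
    assume "L x = L x'"
    then have "L (x - x') = 0"
      using L_add[of "x - x'" x'] by simp
    then show "x = x'"
      using no_root[of "x - x'"] by (auto simp: L_def)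
  qed
  then have "surj L"
    by (simp add: finite_UNIV_inj_surj)
  obtain z where z: "z + \<phi> z + \<phi> (\<phi> z) \<noteq> 0"
    using trace by blast
  \<comment> \<open>By surjectivity of \<open>L\<close>, the product \<open>L x * y\<close> can be
    made equal to an element \<open>z\<close> of nonzero trace.\<close>
  obtain x where "L x = z / y"
    using \<open>surj L\<close> by (metis surjD)
  then have x: "z = L x * y"
    using y by simp
  \<comment> \<open>This is the adjoint relation Tr (L x * y) = Tr (x * r): the nine terms are the
    same on both sides up to a cyclic shift. With \<open>r = 0\<close> the trace of \<open>z\<close>
    would vanish.\<close>
  have "z + \<phi> z + \<phi> (\<phi> z) = x * r + \<phi> x * \<phi> r + \<phi> (\<phi> x) * \<phi> (\<phi> r)"
    unfolding x L_def r_def add mult coeffs cube by (simp add: algebra_simps)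
  then show False
    using z \<open>r = 0\<close> \<phi>_0 by simp
qed

text \<open>The cyclic shift splits the cubic monomials into three orbits of length 3 and the fixed
  monomial \<open>u*v*w\<close>. The three expressions for each of \<alpha>, \<beta>, \<gamma> are
  the coefficients that the product has on the three monomials of one orbit.\<close>

lemma cyclic_product_expansion:
  fixes a\<^sub>1 b\<^sub>1 c\<^sub>1 a\<^sub>2 b\<^sub>2 c\<^sub>2 a\<^sub>3 b\<^sub>3 c\<^sub>3 :: "'a::comm_ring_1"
  assumes "\<alpha> = a\<^sub>1*a\<^sub>2*a\<^sub>3" "\<alpha> = b\<^sub>1*b\<^sub>2*b\<^sub>3" "\<alpha> = c\<^sub>1*c\<^sub>2*c\<^sub>3"
    and "\<beta> = a\<^sub>1*a\<^sub>2*b\<^sub>3 + a\<^sub>1*b\<^sub>2*a\<^sub>3 + b\<^sub>1*a\<^sub>2*a\<^sub>3"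
    and "\<beta> = b\<^sub>1*b\<^sub>2*c\<^sub>3 + b\<^sub>1*c\<^sub>2*b\<^sub>3 + c\<^sub>1*b\<^sub>2*b\<^sub>3"
    and "\<beta> = a\<^sub>1*c\<^sub>2*c\<^sub>3 + c\<^sub>1*c\<^sub>2*a\<^sub>3 + c\<^sub>1*a\<^sub>2*c\<^sub>3"
    and "\<gamma> = a\<^sub>1*a\<^sub>2*c\<^sub>3 + a\<^sub>1*c\<^sub>2*a\<^sub>3 + c\<^sub>1*a\<^sub>2*a\<^sub>3"
    and "\<gamma> = b\<^sub>1*c\<^sub>2*c\<^sub>3 + c\<^sub>1*c\<^sub>2*b\<^sub>3 + c\<^sub>1*b\<^sub>2*c\<^sub>3"
    and "\<gamma> = a\<^sub>1*b\<^sub>2*b\<^sub>3 + b\<^sub>1*a\<^sub>2*b\<^sub>3 + b\<^sub>1*b\<^sub>2*a\<^sub>3"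
    and "\<delta> = a\<^sub>1*b\<^sub>2*c\<^sub>3 + a\<^sub>1*c\<^sub>2*b\<^sub>3 + b\<^sub>1*a\<^sub>2*c\<^sub>3 + b\<^sub>1*c\<^sub>2*a\<^sub>3 + c\<^sub>1*a\<^sub>2*b\<^sub>3 + c\<^sub>1*b\<^sub>2*a\<^sub>3"
  shows "(a\<^sub>1*w + b\<^sub>1*v + c\<^sub>1*u) * (a\<^sub>2*w + b\<^sub>2*v + c\<^sub>2*u) * (a\<^sub>3*w + b\<^sub>3*v + c\<^sub>3*u) =
    \<alpha>*(u^3 + v^3 + w^3) + \<beta>*(v*w^2 + u*v^2 + w*u^2) + \<gamma>*(u*w^2 + v*u^2 + w*v^2) + \<delta>*(u*v*w)"
proof -
  \<comment> \<open>The orbit sums are split because each occurrence of \<alpha>, \<beta>, \<gamma>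
    has to be replaced by a different one of its three expressions; the congruence rules then pair
    every summand with its own equation.\<close>
  have "\<alpha>*(u^3 + v^3 + w^3) + \<beta>*(v*w^2 + u*v^2 + w*u^2) + \<gamma>*(u*w^2 + v*u^2 + w*v^2) + \<delta>*(u*v*w)
    = \<alpha>*w^3 + \<alpha>*v^3 + \<alpha>*u^3 + \<beta>*(v*w^2) + \<beta>*(u*v^2) + \<beta>*(w*u^2)
      + \<gamma>*(u*w^2) + \<gamma>*(v*u^2) + \<gamma>*(w*v^2) + \<delta>*(u*v*w)"
    by (simp add: algebra_simps)
  also have "\<dots> = (a\<^sub>1*a\<^sub>2*a\<^sub>3)*w^3 + (b\<^sub>1*b\<^sub>2*b\<^sub>3)*v^3 + (c\<^sub>1*c\<^sub>2*c\<^sub>3)*u^3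
      + (a\<^sub>1*a\<^sub>2*b\<^sub>3 + a\<^sub>1*b\<^sub>2*a\<^sub>3 + b\<^sub>1*a\<^sub>2*a\<^sub>3)*(v*w^2)
      + (b\<^sub>1*b\<^sub>2*c\<^sub>3 + b\<^sub>1*c\<^sub>2*b\<^sub>3 + c\<^sub>1*b\<^sub>2*b\<^sub>3)*(u*v^2)
      + (a\<^sub>1*c\<^sub>2*c\<^sub>3 + c\<^sub>1*c\<^sub>2*a\<^sub>3 + c\<^sub>1*a\<^sub>2*c\<^sub>3)*(w*u^2)
      + (a\<^sub>1*a\<^sub>2*c\<^sub>3 + a\<^sub>1*c\<^sub>2*a\<^sub>3 + c\<^sub>1*a\<^sub>2*a\<^sub>3)*(u*w^2)
      + (b\<^sub>1*c\<^sub>2*c\<^sub>3 + c\<^sub>1*c\<^sub>2*b\<^sub>3 + c\<^sub>1*b\<^sub>2*c\<^sub>3)*(v*u^2)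
      + (a\<^sub>1*b\<^sub>2*b\<^sub>3 + b\<^sub>1*a\<^sub>2*b\<^sub>3 + b\<^sub>1*b\<^sub>2*a\<^sub>3)*(w*v^2)
      + (a\<^sub>1*b\<^sub>2*c\<^sub>3 + a\<^sub>1*c\<^sub>2*b\<^sub>3 + b\<^sub>1*a\<^sub>2*c\<^sub>3 + b\<^sub>1*c\<^sub>2*a\<^sub>3 + c\<^sub>1*a\<^sub>2*b\<^sub>3 + c\<^sub>1*b\<^sub>2*a\<^sub>3)*(u*v*w)"
    by (intro arg_cong2[where f = "(+)"] arg_cong2[where f = "(*)"] refl assms)
  finally show ?thesis
    by (simp add: algebra_simps power2_eq_square power3_eq_cube)
qed

text \<open>The left side is the determinant with rows
  \<open>(l\<^sub>0, l\<^sub>1, l\<^sub>2)\<close>,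
  \<open>(m\<^sub>2, m\<^sub>0, m\<^sub>1)\<close>,
  \<open>(n\<^sub>1, n\<^sub>2, n\<^sub>0)\<close>, expanded along its first row. On the right
  \<open>v\<close> and \<open>w\<close> are interchanged in comparison with the product expansion,
  since passing to adjoints swaps \<phi> and its square.\<close>

lemma dickson_det_expansion:
  fixes A B C D E u v w :: "'a::comm_ring_1"
  assumes "l\<^sub>0 = 2*E*u + A*v + B*w" "l\<^sub>1 = A*u + 2*C*v" "l\<^sub>2 = B*u + 2*D*w"
    and "m\<^sub>0 = 2*E*v + A*w + B*u" "m\<^sub>1 = A*v + 2*C*w" "m\<^sub>2 = B*v + 2*D*u"
    and "n\<^sub>0 = 2*E*w + A*u + B*v" "n\<^sub>1 = A*w + 2*C*u" "n\<^sub>2 = B*w + 2*D*v"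
    and "- (A^2*D) + A*B*E - B^2*C = 2*\<alpha>"
    and "A^2*C - A*B*D - 2*A*C*D + 2*A*E^2 + B^2*E - 2*B*C*E + 2*B*D^2 = 2*\<beta>"
    and "A^2*E - A*B*C + 2*A*C^2 - 2*A*D*E + B^2*D - 2*B*C*D + 2*B*E^2 = 2*\<gamma>"
    and "A^3 + B^3 + 4*C^3 - 12*C*D*E + 4*D^3 + 4*E^3 = 2*\<delta>"
  shows "l\<^sub>0*(m\<^sub>0*n\<^sub>0 - m\<^sub>1*n\<^sub>2) - l\<^sub>1*(m\<^sub>2*n\<^sub>0 - m\<^sub>1*n\<^sub>1) + l\<^sub>2*(m\<^sub>2*n\<^sub>2 - m\<^sub>0*n\<^sub>1) =
    4*(\<alpha>*(u^3 + w^3 + v^3) + \<beta>*(w*v^2 + u*w^2 + v*u^2) + \<gamma>*(u*v^2 + w*u^2 + v*w^2) + \<delta>*(u*w*v))"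
proof -
  \<comment> \<open>The orbit coefficients are twice the left sides of the system; its right sides
    supply the second factor 2.\<close>
  have "l\<^sub>0*(m\<^sub>0*n\<^sub>0 - m\<^sub>1*n\<^sub>2) - l\<^sub>1*(m\<^sub>2*n\<^sub>0 - m\<^sub>1*n\<^sub>1) + l\<^sub>2*(m\<^sub>2*n\<^sub>2 - m\<^sub>0*n\<^sub>1) =
    2*((- (A^2*D) + A*B*E - B^2*C)*(u^3 + w^3 + v^3)
      + (A^2*C - A*B*D - 2*A*C*D + 2*A*E^2 + B^2*E - 2*B*C*E + 2*B*D^2)*(w*v^2 + u*w^2 + v*u^2)
      + (A^2*E - A*B*C + 2*A*C^2 - 2*A*D*E + B^2*D - 2*B*C*D + 2*B*E^2)*(u*v^2 + w*u^2 + v*w^2)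
      + (A^3 + B^3 + 4*C^3 - 12*C*D*E + 4*D^3 + 4*E^3)*(u*w*v))"
    unfolding assms(1-9) by (simp add: algebra_simps power2_eq_square power3_eq_cube)
  also have "\<dots> = 4*(\<alpha>*(u^3 + w^3 + v^3) + \<beta>*(w*v^2 + u*w^2 + v*u^2) + \<gamma>*(u*v^2 + w*u^2 + v*w^2) + \<delta>*(u*w*v))"
    unfolding assms(10-13) by (simp add: algebra_simps)
  finally show ?thesis .
qed

theorem theorem2p5:
  fixes p m q :: nat
    and K :: "'a::{field,finite} set"
    and a\<^sub>1 b\<^sub>1 c\<^sub>1 a\<^sub>2 b\<^sub>2 c\<^sub>2 a\<^sub>3 b\<^sub>3 c\<^sub>3 :: 'a
    and \<alpha> \<beta> \<gamma> \<delta> :: 'a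
    and E A B C D :: 'a
  assumes "prime p" and "odd p" and "m \<ge> 1" and "q = p ^ m"
    and "CARD('a) = q ^ 3" and "is_subfield K" and "card K = q"
    and "{a\<^sub>1, b\<^sub>1, c\<^sub>1, a\<^sub>2, b\<^sub>2, c\<^sub>2, a\<^sub>3, b\<^sub>3, c\<^sub>3} \<subseteq> K"
    and "\<forall>x. x \<noteq> 0 \<longrightarrow> poly (q_trinomial q a\<^sub>1 b\<^sub>1 c\<^sub>1) x \<noteq> 0"
    and "\<forall>x. x \<noteq> 0 \<longrightarrow> poly (q_trinomial q a\<^sub>2 b\<^sub>2 c\<^sub>2) x \<noteq> 0"
    and "\<forall>x. x \<noteq> 0 \<longrightarrow> poly (q_trinomial q a\<^sub>3 b\<^sub>3 c\<^sub>3) x \<noteq> 0"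
    and "a\<^sub>1*a\<^sub>2*a\<^sub>3 = b\<^sub>1*b\<^sub>2*b\<^sub>3"
    and "b\<^sub>1*b\<^sub>2*b\<^sub>3 = c\<^sub>1*c\<^sub>2*c\<^sub>3"
    and "a\<^sub>1*a\<^sub>2*b\<^sub>3 + a\<^sub>1*b\<^sub>2*a\<^sub>3 + b\<^sub>1*a\<^sub>2*a\<^sub>3 = b\<^sub>1*b\<^sub>2*c\<^sub>3 + b\<^sub>1*c\<^sub>2*b\<^sub>3 + c\<^sub>1*b\<^sub>2*b\<^sub>3"
    and "b\<^sub>1*b\<^sub>2*c\<^sub>3 + b\<^sub>1*c\<^sub>2*b\<^sub>3 + c\<^sub>1*b\<^sub>2*b\<^sub>3 = a\<^sub>1*c\<^sub>2*c\<^sub>3 + c\<^sub>1*c\<^sub>2*a\<^sub>3 + c\<^sub>1*a\<^sub>2*c\<^sub>3"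
    and "a\<^sub>1*a\<^sub>2*c\<^sub>3 + a\<^sub>1*c\<^sub>2*a\<^sub>3 + c\<^sub>1*a\<^sub>2*a\<^sub>3 = b\<^sub>1*c\<^sub>2*c\<^sub>3 + c\<^sub>1*c\<^sub>2*b\<^sub>3 + c\<^sub>1*b\<^sub>2*c\<^sub>3"
    and "b\<^sub>1*c\<^sub>2*c\<^sub>3 + c\<^sub>1*c\<^sub>2*b\<^sub>3 + c\<^sub>1*b\<^sub>2*c\<^sub>3 = a\<^sub>1*b\<^sub>2*b\<^sub>3 + b\<^sub>1*a\<^sub>2*b\<^sub>3 + b\<^sub>1*b\<^sub>2*a\<^sub>3"
    and "\<alpha> = a\<^sub>1*a\<^sub>2*a\<^sub>3"
    and "\<beta> = a\<^sub>1*a\<^sub>2*b\<^sub>3 + a\<^sub>1*b\<^sub>2*a\<^sub>3 + b\<^sub>1*a\<^sub>2*a\<^sub>3"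
    and "\<gamma> = a\<^sub>1*a\<^sub>2*c\<^sub>3 + a\<^sub>1*c\<^sub>2*a\<^sub>3 + c\<^sub>1*a\<^sub>2*a\<^sub>3"
    and "\<delta> = a\<^sub>1*b\<^sub>2*c\<^sub>3 + a\<^sub>1*c\<^sub>2*b\<^sub>3 + b\<^sub>1*a\<^sub>2*c\<^sub>3 + b\<^sub>1*c\<^sub>2*a\<^sub>3 + c\<^sub>1*a\<^sub>2*b\<^sub>3 + c\<^sub>1*b\<^sub>2*a\<^sub>3"
    and "{E, A, B, C, D} \<subseteq> K"
    and "- (A^2*D) + A*B*E - B^2*C = 2*\<alpha>"
    and "A^2*C - A*B*D - 2*A*C*D + 2*A*E^2 + B^2*E - 2*B*C*E + 2*B*D^2 = 2*\<beta>"
    and "A^2*E - A*B*C + 2*A*C^2 - 2*A*D*E + B^2*D - 2*B*C*D + 2*B*E^2 = 2*\<gamma>"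
    and "A^3 + B^3 + 4*C^3 - 12*C*D*E + 4*D^3 + 4*E^3 = 2*\<delta>"
  shows "planar (poly (f_poly q E A B C D))"
proof -
  define \<phi> :: "'a \<Rightarrow> 'a" where "\<phi> x = x ^ q" for x
  \<comment> \<open>The cardinality \<open>q = p ^ m\<close> of \<open>K\<close> vanishes in the
    field, hence so does \<open>p\<close>. This fixes the characteristic and makes the
    \<open>q\<close>-th power map additive.\<close>
  have p0: "of_nat p = (0 :: 'a)"
    using subfield_of_nat_card_eq_0[OF assms(6)] assms(4,7) by simp
  then have "CHAR('a) dvd p"
    by (simp only: of_nat_eq_0_iff_char_dvd)
  then have CHAR: "CHAR('a) = p"
    using assms(1) CHAR_not_1'[where 'a = 'a] unfolding prime_nat_iff One_nat_def by blast
  have "\<not> p dvd 2"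
    using primes_dvd_imp_eq[OF assms(1) two_is_prime_nat] assms(2) by auto
  then have two: "(2 :: 'a) \<noteq> 0"
    using of_nat_eq_0_iff_char_dvd[of 2, where 'a = 'a] CHAR by simp
  then have four: "(4 :: 'a) \<noteq> 0"
    using mult_eq_0_iff[of "2 :: 'a" 2] by simp
  have \<phi>_add: "\<phi> (x + y) = \<phi> x + \<phi> y" for x y
    unfolding \<phi>_def by (rule freshmans_dream'[where n = m]) (use assms(1,4) CHAR in auto)
  have \<phi>_mult: "\<phi> (x * y) = \<phi> x * \<phi> y" for x y
    by (simp add: \<phi>_def power_mult_distrib)
  have \<phi>_K: "\<phi> x = x" if "x \<in> K" for x
    using subfield_power_card[OF assms(6) that] assms(7) by (simp add: \<phi>_def)
  have \<phi>_\<phi>: "x ^ q\<^sup>2 = \<phi> (\<phi> x)" for x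
    by (simp add: \<phi>_def power2_eq_square power_mult)
  \<comment> \<open>The whole field counts as a subfield of itself, with \<open>q ^ 3\<close>
    elements.\<close>
  have \<phi>_3: "\<phi> (\<phi> (\<phi> x)) = x" for x
    using subfield_power_card[of UNIV x] assms(5)
    by (simp add: is_subfield_def \<phi>_def power3_eq_cube power_mult)
  have \<phi>_coeffs: "\<phi> E = E" "\<phi> A = A" "\<phi> B = B" "\<phi> C = C" "\<phi> D = D"
    using assms(22) by (auto intro: \<phi>_K)
  have "1 \<in> K"
    using assms(6) by (simp add: is_subfield_def)
  then have \<phi>_2: "\<phi> 2 = 2"
    using \<phi>_add[of 1 1] \<phi>_K by simp
  have \<phi>_0: "\<phi> 0 = 0"
    using \<phi>_add[of 0 0] by (simp only: add_0_right add_cancel_right_right)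
  have f: "poly (f_poly q E A B C D) x =
      E*x\<^sup>2 + A*(\<phi> x * x) + B*(\<phi> (\<phi> x) * x) + C*(\<phi> x)\<^sup>2 + D*(\<phi> (\<phi> x))\<^sup>2" for x
    unfolding f_poly_def \<phi>_\<phi>[symmetric]
    by (simp add: poly_monom power_add \<phi>_def mult_ac flip: power_mult)
  have P: "poly (q_trinomial q a b c) x = a * \<phi> (\<phi> x) + b * \<phi> x + c * x" for a b c x
    unfolding q_trinomial_def \<phi>_\<phi>[symmetric] by (simp add: poly_monom \<phi>_def)
  \<comment> \<open>Otherwise the trace polynomial, nonzero of degree at most
    \<open>q\<^sup>2\<close>, would have all \<open>q ^ 3\<close> field elements as roots.\<close>
  have trace: "\<exists>z. z + \<phi> z + \<phi> (\<phi> z) \<noteq> 0"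
  proof (rule ccontr)
    assume "\<not> ?thesis"
    then have roots: "{x. poly (q_trinomial q 1 1 1) x = 0} = (UNIV :: 'a set)"
      by (auto simp: P algebra_simps)
    have "q \<ge> 2"
      using one_less_power[of p m] prime_gt_1_nat[OF assms(1)] assms(3,4) by simp
    then have "q < q\<^sup>2" "1 < q\<^sup>2" "q\<^sup>2 < q ^ 3"
      using power_strict_increasing[of 1 2 q] power_strict_increasing[of 0 2 q]
        power_strict_increasing[of 2 3 q] by simp_all
    then have "coeff (q_trinomial q 1 1 1 :: 'a poly) (q\<^sup>2) = 1"
      and deg: "degree (q_trinomial q 1 1 1 :: 'a poly) \<le> q\<^sup>2"
      by (auto simp: q_trinomial_def intro!: degree_add_le degree_monom_le[THEN order_trans])
    then have "q_trinomial q 1 1 1 \<noteq> (0 :: 'a poly)"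
      by auto
    then have "CARD('a) \<le> q\<^sup>2"
      using card_poly_roots_bound[of "q_trinomial q 1 1 1 :: 'a poly"] roots deg by simp
    then show False
      using assms(5) \<open>q\<^sup>2 < q ^ 3\<close> by simp
  qed
  have adjoint: "a * \<phi> u + b * \<phi> (\<phi> u) + c * u \<noteq> 0"
    if "{a, b, c} \<subseteq> K" "\<forall>x. x \<noteq> 0 \<longrightarrow> poly (q_trinomial q a b c) x \<noteq> 0" "u \<noteq> 0" for a b c u
    using that by (intro adjoint_no_root[of \<phi>] \<phi>_add \<phi>_mult \<phi>_3 trace) (auto simp: P \<phi>_K)
  have "inj (\<lambda>x. poly (f_poly q E A B C D) (x + u) - poly (f_poly q E A B C D) x)"
    if "u \<noteq> 0" for u
  proof (rule injI)
    fix x y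
    assume eq: "poly (f_poly q E A B C D) (x + u) - poly (f_poly q E A B C D) x =
      poly (f_poly q E A B C D) (y + u) - poly (f_poly q E A B C D) y"
    define v w where "v = \<phi> u" and "w = \<phi> v"
    define z where "z = x - y"
    have \<phi>_uvw: "\<phi> u = v" "\<phi> v = w" "\<phi> w = u"
      by (simp_all add: v_def w_def \<phi>_3)
    \<comment> \<open>The \<open>l\<close> are the coefficients of the linearized difference map at
      \<open>u\<close>; the \<open>m\<close> and \<open>n\<close> are their images under \<phi> and
      its square, which shift \<open>u\<close>, \<open>v\<close>, \<open>w\<close> cyclically and
      fix the coefficients of the form.\<close>
    define l\<^sub>0 l\<^sub>1 l\<^sub>2 where l: "l\<^sub>0 = 2*E*u + A*v + B*w" "l\<^sub>1 = A*u + 2*C*v" "l\<^sub>2 = B*u + 2*D*w"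
    define m\<^sub>0 m\<^sub>1 m\<^sub>2 where m: "m\<^sub>0 = 2*E*v + A*w + B*u" "m\<^sub>1 = A*v + 2*C*w" "m\<^sub>2 = B*v + 2*D*u"
    define n\<^sub>0 n\<^sub>1 n\<^sub>2 where n: "n\<^sub>0 = 2*E*w + A*u + B*v" "n\<^sub>1 = A*w + 2*C*u" "n\<^sub>2 = B*w + 2*D*v"
    have x: "x = z + y"
      by (simp add: z_def)
    \<comment> \<open>In \<open>eq\<close> the values of the form at \<open>u\<close> cancel, which
      leaves its polarization at \<open>z\<close> and \<open>u\<close>.\<close>
    have row\<^sub>0: "l\<^sub>0 * z + l\<^sub>1 * \<phi> z + l\<^sub>2 * \<phi> (\<phi> z) = 0"
      using eq unfolding f x \<phi>_add \<phi>_uvw l by (simp add: algebra_simps power2_eq_square)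
    \<comment> \<open>Applying \<phi> also shifts the unknowns \<open>z\<close>,
      \<open>\<phi> z\<close>, \<open>\<phi> (\<phi> z)\<close>, so the coefficients move one column
      to the right, the last one coming first.\<close>
    have row\<^sub>1: "m\<^sub>2 * z + m\<^sub>0 * \<phi> z + m\<^sub>1 * \<phi> (\<phi> z) = 0"
      using arg_cong[OF row\<^sub>0, of \<phi>]
      by (simp add: l m \<phi>_add \<phi>_mult \<phi>_coeffs \<phi>_uvw \<phi>_2 \<phi>_0 \<phi>_3 add_ac)
    have row\<^sub>2: "n\<^sub>1 * z + n\<^sub>2 * \<phi> z + n\<^sub>0 * \<phi> (\<phi> z) = 0"
      using arg_cong[OF row\<^sub>1, of \<phi>]
      by (simp add: m n \<phi>_add \<phi>_mult \<phi>_coeffs \<phi>_uvw \<phi>_2 \<phi>_0 \<phi>_3 add_ac)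
    define det where
      "det = l\<^sub>0*(m\<^sub>0*n\<^sub>0 - m\<^sub>1*n\<^sub>2) - l\<^sub>1*(m\<^sub>2*n\<^sub>0 - m\<^sub>1*n\<^sub>1) + l\<^sub>2*(m\<^sub>2*n\<^sub>2 - m\<^sub>0*n\<^sub>1)"
    have "det = 4*(\<alpha>*(u^3 + w^3 + v^3) + \<beta>*(w*v^2 + u*w^2 + v*u^2)
        + \<gamma>*(u*v^2 + w*u^2 + v*w^2) + \<delta>*(u*w*v))"
      unfolding det_def by (rule dickson_det_expansion[OF l m n assms(23-26)])
    also have "\<dots> = 4*((a\<^sub>1*v + b\<^sub>1*w + c\<^sub>1*u) * (a\<^sub>2*v + b\<^sub>2*w + c\<^sub>2*u) * (a\<^sub>3*v + b\<^sub>3*w + c\<^sub>3*u))"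
      by (subst cyclic_product_expansion[where \<alpha> = \<alpha> and \<beta> = \<beta> and \<gamma> = \<gamma> and \<delta> = \<delta>])
        (use assms(12-21) in simp_all)
    finally have "det \<noteq> 0"
      using four assms(8) adjoint[OF _ assms(9) \<open>u \<noteq> 0\<close>] adjoint[OF _ assms(10) \<open>u \<noteq> 0\<close>]
        adjoint[OF _ assms(11) \<open>u \<noteq> 0\<close>]
      by (simp add: \<phi>_uvw)
    \<comment> \<open>Cramer's rule: the three equations are weighted by the cofactors of the first
      column, so that only the unknown \<open>z\<close> survives.\<close>
    moreover have "det * z = (m\<^sub>0*n\<^sub>0 - m\<^sub>1*n\<^sub>2) * (l\<^sub>0 * z + l\<^sub>1 * \<phi> z + l\<^sub>2 * \<phi> (\<phi> z))
        + (l\<^sub>2*n\<^sub>2 - l\<^sub>1*n\<^sub>0) * (m\<^sub>2 * z + m\<^sub>0 * \<phi> z + m\<^sub>1 * \<phi> (\<phi> z))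
        + (l\<^sub>1*m\<^sub>1 - l\<^sub>2*m\<^sub>0) * (n\<^sub>1 * z + n\<^sub>2 * \<phi> z + n\<^sub>0 * \<phi> (\<phi> z))"
      unfolding det_def by (simp add: algebra_simps)
    ultimately show "x = y"
      using row\<^sub>0 row\<^sub>1 row\<^sub>2 by (simp add: z_def)
  qed
  then show ?thesis
    unfolding planar_def by (simp add: bij_def finite_UNIV_inj_surj)
qed

end
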